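(* For any $x\in X$, $t\in\mathbb{R}_+$ and $n\in\mathbb{N}_0$, $$\mathbb{P}_{(x,0)}(\eta(t)=n)\le e^{-\underline{\lambda}t}\,\frac{(\bar{\lambda}t)^n}{n!}.$$
   Context: Notation and model. $\mathbb{R}_+=[0,\infty)$, $\mathbb{N}_0=\{0,1,2,\ldots\}$, $\mathcal{B}(E)$ is the Borel $\sigma$-field of $E$. $(Y,\rho_Y)$ is a non-empty complete separable metric space, $I$ is a non-empty finite set with the discrete topology, $X:=Y\times I$ and $\bar{X}:=X\times\mathbb{R}_+$ have the product topologies. $\{S_i: i\in I\}$ are jointly continuous semiflows $S_i:\mathbb{R}_+\times Y\to Y$, i.e. $S_i(s,S_i(t,y))=S_i(s+t,y)$ and $S_i(0,y)=y$. $\{\pi_{ij}: i,j\in I\}$ are continuous maps $Y\to[0,1]$ with $\sum_{j\in I}\pi_{ij}(y)=1$ for all $i\in I$, $y\in Y$. $\lambda:Y\to(0,\infty)$ is continuous with $\underline{\lambda}\le\lambda(y)\le\bar{\lambda}$ for all $y\in Y$, for constants $\underline{\lambda},\bar{\lambda}>0$. Put $\Lambda(y,i,t):=\int_0^t\lambda(S_i(h,y))\,dh$. $J:Y\times\mathcal{B}(Y)\to[0,1]$ is a stochastic kernel. Define the stochastic kernel $\bar{P}$ on $\bar{X}$ by $$\bar{P}((y,i,s),\bar{A})=\int_0^\infty\lambda(S_i(t,y))e^{-\Lambda(y,i,t)}\int_Y\sum_{j\in I}\pi_{ij}(u)\mathbf{1}_{\bar{A}}(u,j,s+t)\,J(S_i(t,y),du)\,dt.$$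 For $\bar x\in\bar X$, $\mathbb{P}_{\bar x}$ is the law under which $\bar{\Phi}=\{(Y_n,\xi_n,\tau_n)\}_{n\in\mathbb{N}_0}$ is the (canonical) time-homogeneous Markov chain on $\bar X$ with transition law $\bar P$ started at $\bar x$; then $\{\tau_n\}$ is a.s. strictly increasing to infinity. Finally, $\eta(t):=\max\{n\in\mathbb{N}_0:\tau_n\le t\}$ for $t\in\mathbb{R}_+$. *)

theory Defs
  imports "HOL-Probability.Probability"
begin

section \<open>The canonical Markov chain of a transition kernel\<close>

text \<open>
  The law, on the path space \<open>nat \<Rightarrow> 'a\<close>, of the coordinate process that starts at \<open>x\<close> and moves
  according to the kernel \<open>K\<close> on \<open>M\<close>. It is the Ionescu-Tulcea measure whose 0-th kernel is the
  point mass at \<open>x\<close> and whose next kernels look at the last state of the history only. For a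
  probability kernel \<open>K\<close> and \<open>x \<in> space M\<close> these satisfy the assumptions of the locale
  \<^locale>\<open>Ionescu_Tulcea\<close>, and the constant below is the measure called \<open>PF.lim\<close> there.
\<close>

definition markov_step :: "'a measure \<Rightarrow> ('a \<Rightarrow> 'a measure) \<Rightarrow> 'a \<Rightarrow> nat \<Rightarrow> (nat \<Rightarrow> 'a) \<Rightarrow> 'a measure"
  where "markov_step M K x n \<omega> = (case n of 0 \<Rightarrow> return M x | Suc m \<Rightarrow> K (\<omega> m))"

definition markov_law :: "'a measure \<Rightarrow> ('a \<Rightarrow> 'a measure) \<Rightarrow> 'a \<Rightarrow> (nat \<Rightarrow> 'a) measure"
  where "markov_law M K x =
    projective_family.lim UNIV (Ionescu_Tulcea.CI (markov_step M K x) (\<lambda>_. M)) (\<lambda>_. M)"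

section \<open>The model\<close>

text \<open>Semiflows are indexed by real times, but only their values at times \<open>t \<ge> 0\<close> are constrained.\<close>

definition cont_semiflow :: "(real \<Rightarrow> 'y::topological_space \<Rightarrow> 'y) \<Rightarrow> bool"
  where "cont_semiflow \<phi> \<longleftrightarrow>
    continuous_on ({0..} \<times> UNIV) (\<lambda>(t, y). \<phi> t y) \<and>
    (\<forall>y. \<phi> 0 y = y) \<and>
    (\<forall>s\<ge>0. \<forall>t\<ge>0. \<forall>y. \<phi> s (\<phi> t y) = \<phi> (s + t) y)"

definition Lam :: "('i \<Rightarrow> real \<Rightarrow> 'y \<Rightarrow> 'y) \<Rightarrow> ('y \<Rightarrow> real) \<Rightarrow> 'y \<Rightarrow> 'i \<Rightarrow> real \<Rightarrow> real"
  where "Lam S lam y i t = (LBINT h:{0..t}. lam (S i h y))"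

text \<open>
  The state space \<open>Y \<times> I \<times> [0, \<infinity>)\<close>. As \<open>Y\<close> is second countable and \<open>I\<close> is finite, the product of
  the three sigma-fields is the Borel sigma-field of the product topology.
\<close>

definition Xbar :: "('y::polish_space \<times> 'i::finite \<times> real) measure"
  where "Xbar = borel \<Otimes>\<^sub>M (count_space UNIV \<Otimes>\<^sub>M restrict_space borel {0..})"

definition Pbar ::
    "('i::finite \<Rightarrow> real \<Rightarrow> 'y::polish_space \<Rightarrow> 'y) \<Rightarrow> ('i \<Rightarrow> 'i \<Rightarrow> 'y \<Rightarrow> real) \<Rightarrow> ('y \<Rightarrow> real) \<Rightarrow>
     ('y \<Rightarrow> 'y measure) \<Rightarrow> 'y \<times> 'i \<times> real \<Rightarrow> ('y \<times> 'i \<times> real) measure"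
  where "Pbar S p lam J = (\<lambda>(y, i, s). measure_of (space Xbar) (sets Xbar) (\<lambda>A.
    \<integral>\<^sup>+t\<in>{0..}. ennreal (lam (S i t y) * exp (- Lam S lam y i t)) *
      (\<integral>\<^sup>+u. (\<Sum>j\<in>UNIV. ennreal (p i j u) * indicator A (u, j, s + t)) \<partial>J (S i t y)) \<partial>lborel))"

text \<open>
  On paths for which infinitely many (or no) jump times are at most \<open>t\<close>, the maximum is not
  meaningful and the value of \<open>eta\<close> is an unspecified natural number; such paths form a null set.
\<close>

definition eta :: "(nat \<Rightarrow> 'y \<times> 'i \<times> real) \<Rightarrow> real \<Rightarrow> nat"
  where "eta \<omega> t = Max {n. snd (snd (\<omega> n)) \<le> t}"

end

theory Submission
  imports Defs
begin

text \<open>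
  Write \<open>\<tau>\<close> for the clock component of a state. If only finitely many jump times are at most \<open>t\<close>, and
  at least one is, then \<open>eta \<omega> t = n\<close> forces \<open>\<tau>\<^sub>n \<le> t < \<tau>\<^sub>n\<^sub>+\<^sub>1\<close>. So the proof bounds the probability of
  the latter event and shows that the former condition holds almost surely.

  From a state with clock \<open>s \<le> t\<close>, the chance that the next jump comes after \<open>t\<close> is the exponential of
  minus the hazard accumulated over a period of length \<open>t - s\<close>, hence at most
  \<open>exp (- lam_lo * (t - s))\<close>. The probability of \<open>\<tau>\<^sub>n \<le> t < \<tau>\<^sub>n\<^sub>+\<^sub>1\<close> is therefore at most the expectation
  of \<open>B\<^sub>0 \<tau>\<^sub>n\<close>, where \<open>B\<^sub>m s = exp (- l * (t - s)) * (lam_hi * (t - s)) ^ m / fact m\<close> for \<open>s \<le> t\<close>,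
  \<open>B\<^sub>m s = 0\<close> for \<open>s > t\<close>, and \<open>l = lam_lo\<close>. One step of the kernel maps \<open>B\<^sub>m\<close> below \<open>B\<^sub>m\<^sub>+\<^sub>1\<close>
  (lemma \<open>P_weight_le\<close>): the waiting-time density at \<open>u\<close> is at most \<open>lam_hi * exp (- l * u)\<close>, the two
  exponentials multiply to the constant \<open>exp (- l * (t - s))\<close>, and integrating the \<open>m\<close>-th power of the
  remaining time produces the next power and the next factorial. Moving back through the \<open>n\<close> steps
  (lemma \<open>law_weight_le\<close>) leaves \<open>B\<^sub>n\<close> at the initial clock, which is the asserted bound.

  The same comparison with \<open>l = 0\<close>, for which \<open>B\<^sub>0\<close> is the indicator of \<open>{..t}\<close>, bounds the probability
  of \<open>\<tau>\<^sub>k \<le> t\<close> by the \<open>k\<close>-th term of an exponential series. These bounds are summable in \<open>k\<close>, so by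
  Borel-Cantelli almost surely only finitely many jump times are at most \<open>t\<close>.

  The chain enters only through the one-step formula \<open>nn_integral_law_step\<close>, and the kernel only
  through the law of the clock after one step, \<open>nn_integral_P_clock\<close>.
\<close>

section \<open>Coordinates of the canonical Markov chain\<close>

locale markov_kernel =
  fixes M :: "'a measure" and K :: "'a \<Rightarrow> 'a measure" and x :: 'a
  assumes kernel [measurable]: "K \<in> M \<rightarrow>\<^sub>M prob_algebra M"
    and start: "x \<in> space M"
begin

lemma kernel_subprob [measurable]: "K \<in> M \<rightarrow>\<^sub>M subprob_algebra M"
  by (rule measurable_prob_algebraD) (rule kernel)

lemma prob_space_kernel: "z \<in> space M \<Longrightarrow> prob_space (K z)"
  using measurable_space[OF kernel] by (auto simp: space_prob_algebra)

lemma Ionescu_Tulcea_markov_step: "Ionescu_Tulcea (markov_step M K x) (\<lambda>_. M)"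
proof (rule Ionescu_Tulcea.intro)
  fix i
  show "markov_step M K x i \<in> (\<Pi>\<^sub>M j\<in>{0..<i}. M) \<rightarrow>\<^sub>M subprob_algebra M"
  proof (cases i)
    case 0
    have "return M x \<in> space (subprob_algebra M)"
      using start by (auto simp: space_subprob_algebra prob_space_return intro: prob_space_imp_subprob_space)
    with 0 show ?thesis by (simp add: markov_step_def[abs_def])
  next
    case (Suc m)
    have "(\<lambda>\<omega>. \<omega> m) \<in> (\<Pi>\<^sub>M j\<in>{0..<i}. M) \<rightarrow>\<^sub>M M"
      by (rule measurable_component_singleton) (simp add: Suc)
    from measurable_compose[OF this kernel_subprob] Suc show ?thesis
      by (simp add: markov_step_def[abs_def])
  qed
next
  fix i and \<omega> :: "nat \<Rightarrow> 'a"
  assume \<omega>: "\<omega> \<in> space (\<Pi>\<^sub>M j\<in>{0..<i}. M)"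
  show "prob_space (markov_step M K x i \<omega>)"
  proof (cases i)
    case 0 with start show ?thesis by (simp add: markov_step_def prob_space_return)
  next
    case (Suc m)
    with \<omega> have "\<omega> m \<in> space M" by (auto simp: space_PiM PiE_iff)
    with Suc show ?thesis by (simp add: markov_step_def prob_space_kernel)
  qed
qed

sublocale IT: Ionescu_Tulcea "markov_step M K x" "\<lambda>_. M"
  by (rule Ionescu_Tulcea_markov_step)

abbreviation law :: "(nat \<Rightarrow> 'a) measure"
  where "law \<equiv> markov_law M K x"

lemma sets_law [measurable_cong]: "sets law = sets (\<Pi>\<^sub>M j\<in>UNIV. M)"
  unfolding markov_law_def by simp

lemma space_law: "space law = space (\<Pi>\<^sub>M j\<in>UNIV. M)"
  by (rule sets_eq_imp_space_eq) (rule sets_law)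

lemma coordinate_in_space: "\<omega> \<in> space law \<Longrightarrow> \<omega> k \<in> space M"
  by (auto simp: space_law space_PiM PiE_iff)

lemma measurable_coordinate [measurable]: "(\<lambda>\<omega>. \<omega> k) \<in> law \<rightarrow>\<^sub>M M"
  by (subst measurable_cong_sets[OF sets_law refl]) (rule measurable_component_singleton, simp)

text \<open>
  The law is the projective limit of the finite iterates \<open>IT.C 0 n\<close>, so functions of the first \<open>n\<close>
  coordinates can be integrated against an explicit iterated bind.
\<close>

lemma nn_integral_law_initial_segment:
  assumes f [measurable]: "f \<in> borel_measurable (\<Pi>\<^sub>M j\<in>{0..<n}. M)"
  shows "(\<integral>\<^sup>+\<omega>. f (restrict \<omega> {0..<n}) \<partial>law) = (\<integral>\<^sup>+\<omega>. f \<omega> \<partial>IT.C 0 n (\<lambda>_. undefined))"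
proof -
  have up: "IT.up_to {0..<n} = n"
    by (rule antisym) (auto simp: IT.up_to_iff,
        metis IT.up_to_iff_Ico finite_atLeastLessThan atLeastLessThan_subset_iff order_refl le_0_eq)
  have [measurable]: "(\<lambda>\<omega>. restrict \<omega> {0..<n}) \<in> law \<rightarrow>\<^sub>M (\<Pi>\<^sub>M j\<in>{0..<n}. M)"
    by (subst measurable_cong_sets[OF sets_law refl]) (rule measurable_restrict_subset, simp)
  have "(\<integral>\<^sup>+\<omega>. f (restrict \<omega> {0..<n}) \<partial>law)
      = (\<integral>\<^sup>+\<omega>. f \<omega> \<partial>distr law (\<Pi>\<^sub>M j\<in>{0..<n}. M) (\<lambda>\<omega>. restrict \<omega> {0..<n}))"
    by (subst nn_integral_distr) auto
  also have "distr law (\<Pi>\<^sub>M j\<in>{0..<n}. M) (\<lambda>\<omega>. restrict \<omega> {0..<n}) = IT.CI {0..<n}"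
    unfolding markov_law_def by (rule IT.distr_lim) simp
  also have "\<dots> = IT.C 0 n (\<lambda>_. undefined)"
    unfolding IT.CI_def up using IT.distr_C[of n n "\<lambda>_. undefined" 0] by simp
  finally show ?thesis .
qed

lemma nn_integral_law_start:
  assumes h [measurable]: "h \<in> borel_measurable M"
  shows "(\<integral>\<^sup>+\<omega>. h (\<omega> 0) \<partial>law) = h x"
proof -
  have c [measurable]: "(\<lambda>\<omega>. \<omega> 0) \<in> (\<Pi>\<^sub>M j\<in>{0..<Suc 0}. M) \<rightarrow>\<^sub>M M"
    by (rule measurable_component_singleton) simp
  have u: "(\<lambda>_. undefined) \<in> space (\<Pi>\<^sub>M j\<in>{0..<0::nat}. M)" by simp
  have "(\<integral>\<^sup>+\<omega>. h (\<omega> 0) \<partial>law) = (\<integral>\<^sup>+\<omega>. h (restrict \<omega> {0..<Suc 0} 0) \<partial>law)"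
    by simp
  also have "\<dots> = (\<integral>\<^sup>+\<omega>. h (\<omega> 0) \<partial>IT.C 0 (Suc 0) (\<lambda>_. undefined))"
    by (rule nn_integral_law_initial_segment) measurable
  also have "IT.C 0 (Suc 0) (\<lambda>_. undefined) = IT.eP 0 (\<lambda>_. undefined)"
    unfolding IT.C.simps add_0 by (rule bind_return[OF IT.measurable_eP u])
  also have "(\<integral>\<^sup>+\<omega>. h (\<omega> 0) \<partial>IT.eP 0 (\<lambda>_. undefined)) = (\<integral>\<^sup>+z. h z \<partial>return M x)"
    by (subst IT.nn_integral_eP) (auto simp: markov_step_def)
  also have "\<dots> = h x"
    using start by (simp add: nn_integral_return)
  finally show ?thesis .
qed

lemma prob_space_law: "prob_space law"
  by (rule prob_spaceI) (use nn_integral_law_start[of "\<lambda>_. 1"] in simp)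

text \<open>
  The Markov property for consecutive coordinates. Conditioning on the coordinate \<open>n\<close>, instead of on
  the first step, avoids shifting paths: an expectation over \<open>\<omega> (Suc n)\<close> turns into one over \<open>\<omega> n\<close>.
\<close>

lemma nn_integral_law_step:
  assumes h [measurable]: "case_prod h \<in> borel_measurable (M \<Otimes>\<^sub>M M)"
  shows "(\<integral>\<^sup>+\<omega>. h (\<omega> n) (\<omega> (Suc n)) \<partial>law) = (\<integral>\<^sup>+\<omega>. (\<integral>\<^sup>+z. h (\<omega> n) z \<partial>K (\<omega> n)) \<partial>law)"
proof -
  let ?u = "\<lambda>_::nat. undefined :: 'a"
  have u: "?u \<in> space (\<Pi>\<^sub>M j\<in>{0..<0::nat}. M)" by simp
  have c [measurable]: "(\<lambda>\<omega>. \<omega> k) \<in> (\<Pi>\<^sub>M j\<in>{0..<m}. M) \<rightarrow>\<^sub>M M" if "k < m" for k m :: nat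
    using that by (intro measurable_component_singleton) simp
  have hc [measurable]: "(\<lambda>\<omega>. h (\<omega> n) (\<omega> (Suc n))) \<in> borel_measurable (\<Pi>\<^sub>M j\<in>{0..<Suc (Suc n)}. M)"
    by (rule measurable_compose[OF measurable_Pair[OF c c] h, simplified]) auto
  have Kh [measurable]: "(\<lambda>y. \<integral>\<^sup>+z. h y z \<partial>K y) \<in> borel_measurable M"
    by (rule nn_integral_measurable_subprob_algebra2[OF h kernel_subprob])
  have [measurable]: "(\<lambda>\<omega>. \<integral>\<^sup>+z. h (\<omega> n) z \<partial>K (\<omega> n)) \<in> borel_measurable (\<Pi>\<^sub>M j\<in>{0..<Suc n}. M)"
    by (rule measurable_compose[OF c Kh]) simp
  have eP: "IT.eP (Suc n) \<in> IT.C 0 (Suc n) ?u \<rightarrow>\<^sub>M subprob_algebra (\<Pi>\<^sub>M j\<in>{0..<Suc (Suc n)}. M)"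
    using IT.measurable_eP[of "Suc n"]
    by (subst measurable_cong_sets[OF IT.sets_C[OF u] refl]) (simp only: add_0)
  have "(\<integral>\<^sup>+\<omega>. h (\<omega> n) (\<omega> (Suc n)) \<partial>law)
      = (\<integral>\<^sup>+\<omega>. h (restrict \<omega> {0..<Suc (Suc n)} n) (restrict \<omega> {0..<Suc (Suc n)} (Suc n)) \<partial>law)"
    by simp
  also have "\<dots> = (\<integral>\<^sup>+\<omega>. h (\<omega> n) (\<omega> (Suc n)) \<partial>IT.C 0 (Suc (Suc n)) ?u)"
    by (rule nn_integral_law_initial_segment) measurable
  also have "\<dots> = (\<integral>\<^sup>+\<omega>. (\<integral>\<^sup>+\<omega>'. h (\<omega>' n) (\<omega>' (Suc n)) \<partial>IT.eP (Suc n) \<omega>) \<partial>IT.C 0 (Suc n) ?u)"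
    unfolding IT.C.simps(2)[of 0 "Suc n"] add_0
    by (rule nn_integral_bind[OF hc eP])
  also have "\<dots> = (\<integral>\<^sup>+\<omega>. (\<integral>\<^sup>+z. h (\<omega> n) z \<partial>K (\<omega> n)) \<partial>IT.C 0 (Suc n) ?u)"
  proof (rule nn_integral_cong)
    fix \<omega> assume "\<omega> \<in> space (IT.C 0 (Suc n) ?u)"
    then have "\<omega> \<in> space (\<Pi>\<^sub>M j\<in>{0..<Suc n}. M)"
      by (simp only: IT.space_C[OF u] add_0)
    then show "(\<integral>\<^sup>+\<omega>'. h (\<omega>' n) (\<omega>' (Suc n)) \<partial>IT.eP (Suc n) \<omega>) = (\<integral>\<^sup>+z. h (\<omega> n) z \<partial>K (\<omega> n))"
      by (subst IT.nn_integral_eP) (simp_all add: markov_step_def)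
  qed
  also have "\<dots> = (\<integral>\<^sup>+\<omega>. (\<integral>\<^sup>+z. h (restrict \<omega> {0..<Suc n} n) z \<partial>K (restrict \<omega> {0..<Suc n} n)) \<partial>law)"
    by (rule nn_integral_law_initial_segment[symmetric]) measurable
  finally show ?thesis by simp
qed

end

section \<open>Waiting times with a continuous hazard rate\<close>

text \<open>
  A waiting time with hazard rate \<open>g\<close> exceeds \<open>a\<close> with the exponential of minus the accumulated
  hazard as its probability, since \<open>g u * exp (- G u)\<close> is the derivative of \<open>- exp (- G u)\<close> for every
  antiderivative \<open>G\<close> of \<open>g\<close>. The positive lower bound on \<open>g\<close> makes the boundary term at infinity vanish.
\<close>

lemma
  fixes g :: "real \<Rightarrow> real"
  assumes cont: "continuous_on UNIV g" and lo: "0 < c" "\<And>u. c \<le> g u" and a: "0 \<le> a"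
  shows cumulative_hazard_ge: "c * a \<le> (LBINT h:{0..a}. g h)"
    and nn_integral_hazard_tail:
      "(\<integral>\<^sup>+u. ennreal (g u * exp (- (LBINT h:{0..u}. g h))) * indicator {a..} u \<partial>lborel)
        = ennreal (exp (- (LBINT h:{0..a}. g h)))"
proof -
  have g_pos: "0 < g u" for u using lo(1) lo(2)[of u] by linarith
  have [measurable]: "g \<in> borel_measurable borel"
    by (rule borel_measurable_continuous_onI) (rule cont)
  \<comment> \<open>The integral over \<open>{0..u}\<close> has in general only a one-sided derivative at \<open>0\<close>, as it vanishes
    for negative \<open>u\<close>. An antiderivative on the whole line is differentiable there too.\<close>
  have "\<exists>G. \<forall>u::real. - \<infinity> < ereal u \<longrightarrow> ereal u < \<infinity> \<longrightarrow> (G has_vector_derivative g u) (at u)"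
    using cont by (intro einterval_antiderivative) (auto simp: continuous_on_eq_continuous_at)
  then obtain G where G: "\<And>u. (G has_real_derivative g u) (at u)"
    by (auto simp: has_real_derivative_iff_has_vector_derivative)
  have Lam: "(LBINT h:{0..u}. g h) = G u - G 0" if "0 \<le> u" for u
    using integral_FTC_Icc_nonneg[of g 0 u G] G g_pos that
    by (simp add: set_lebesgue_integral_def less_imp_le mult.commute)
  have G_ge: "c * u \<le> G u - G 0" if "0 \<le> u" for u
  proof -
    have "G 0 - c * 0 \<le> G u - c * u"
      using that lo by (intro DERIV_nonneg_imp_nondecreasing[of 0 u "\<lambda>u. G u - c * u"])
        (auto intro!: exI derivative_eq_intros G)
    then show ?thesis by simp
  qed
  show "c * a \<le> (LBINT h:{0..a}. g h)" using G_ge Lam a by simp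
  have "filterlim (\<lambda>u. c * u) at_top at_top"
    using lo(1) by (intro filterlim_tendsto_pos_mult_at_top[OF tendsto_const]) (auto simp: filterlim_ident)
  then have "filterlim (\<lambda>u. G u - G 0) at_top at_top"
    by (rule filterlim_at_top_mono) (use eventually_ge_at_top[of 0] in \<open>eventually_elim, auto intro: G_ge\<close>)
  then have "((\<lambda>u. exp (- (G u - G 0))) \<longlongrightarrow> 0) at_top"
    by (intro filterlim_compose[OF exp_at_bot]) (simp only: filterlim_uminus_at_bot minus_minus)
  then have lim: "((\<lambda>u. - exp (- (G u - G 0))) \<longlongrightarrow> 0) at_top"
    using tendsto_minus by fastforce
  have [measurable]: "G \<in> borel_measurable borel"
    using G by (intro borel_measurable_continuous_onI continuous_at_imp_continuous_on) (auto intro: DERIV_isCont)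
  have "(\<integral>\<^sup>+u. ennreal (g u * exp (- (LBINT h:{0..u}. g h))) * indicator {a..} u \<partial>lborel)
      = (\<integral>\<^sup>+u. ennreal (g u * exp (- (G u - G 0))) * indicator {a..} u \<partial>lborel)"
    using a by (intro nn_integral_cong) (auto simp: Lam split: split_indicator)
  also have "\<dots> = ennreal (0 - (- exp (- (G a - G 0))))"
    using g_pos by (intro nn_integral_FTC_atLeast lim)
      (auto intro!: derivative_eq_intros G simp: less_imp_le)
  finally show "(\<integral>\<^sup>+u. ennreal (g u * exp (- (LBINT h:{0..u}. g h))) * indicator {a..} u \<partial>lborel)
        = ennreal (exp (- (LBINT h:{0..a}. g h)))"
    using a by (simp add: Lam)
qed

section \<open>The jump kernel\<close>

locale semiflow_jump_model =
  fixes S :: "'i::finite \<Rightarrow> real \<Rightarrow> 'y::polish_space \<Rightarrow> 'y"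
    and p :: "'i \<Rightarrow> 'i \<Rightarrow> 'y \<Rightarrow> real"
    and lam :: "'y \<Rightarrow> real"
    and J :: "'y \<Rightarrow> 'y measure"
    and lam_lo lam_hi :: real
  assumes semiflow: "\<And>i. cont_semiflow (S i)"
    and p_cont: "\<And>i j. continuous_on UNIV (p i j)"
    and p_nonneg: "\<And>i j y. 0 \<le> p i j y"
    and p_sum: "\<And>i y. (\<Sum>j\<in>UNIV. p i j y) = 1"
    and lam_cont: "continuous_on UNIV lam"
    and lam_lo_pos: "0 < lam_lo"
    and lam_bounds: "\<And>y. lam_lo \<le> lam y" "\<And>y. lam y \<le> lam_hi"
    and J_kernel: "J \<in> borel \<rightarrow>\<^sub>M prob_algebra borel"
begin

abbreviation X :: "('y \<times> 'i \<times> real) measure"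
  where "X \<equiv> Xbar"

abbreviation P :: "'y \<times> 'i \<times> real \<Rightarrow> ('y \<times> 'i \<times> real) measure"
  where "P \<equiv> Pbar S p lam J"

abbreviation clock :: "'y \<times> 'i \<times> real \<Rightarrow> real"
  where "clock z \<equiv> snd (snd z)"

text \<open>
  The semiflows are arbitrary at negative times. Clamping the time at \<open>0\<close> gives a map that is
  continuous, hence measurable, on all of the real line.
\<close>

definition flow :: "'y \<times> 'i \<times> real \<Rightarrow> real \<Rightarrow> 'y"
  where "flow z u = S (fst (snd z)) (max 0 u) (fst z)"

definition hazard :: "'y \<times> 'i \<times> real \<Rightarrow> real \<Rightarrow> real"
  where "hazard z u = (LBINT h:{0..u}. lam (flow z h))"

definition wait_density :: "'y \<times> 'i \<times> real \<Rightarrow> real \<Rightarrow> ennreal"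
  where "wait_density z u = ennreal (lam (flow z u) * exp (- hazard z u)) * indicator {0..} u"

text \<open>
  The probability that a jump from \<open>z\<close> after the waiting time \<open>u\<close> ends in \<open>A\<close>. The time is clamped here
  as well, so that the new clock is never negative and the new state belongs to the state space.
\<close>

definition landing :: "'y \<times> 'i \<times> real \<Rightarrow> real \<Rightarrow> ('y \<times> 'i \<times> real) set \<Rightarrow> ennreal"
  where "landing z u A =
    (\<integral>\<^sup>+v. (\<Sum>j\<in>UNIV. ennreal (p (fst (snd z)) j v) * indicator A (v, j, clock z + max 0 u)) \<partial>J (flow z u))"

lemma lam_pos: "0 < lam y"
  using lam_lo_pos lam_bounds(1)[of y] by linarith

lemma measurable_clock [measurable]: "clock \<in> X \<rightarrow>\<^sub>M borel"
proof -
  have "(\<lambda>s. s) \<in> restrict_space borel {0::real..} \<rightarrow>\<^sub>M borel"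
    by (rule measurable_restrict_space1) simp
  then show ?thesis unfolding Xbar_def
    by (rule measurable_compose[rotated]) measurable
qed

lemma measurable_fst_X [measurable]: "fst \<in> X \<rightarrow>\<^sub>M borel"
  unfolding Xbar_def by measurable

lemma measurable_index [measurable]: "(\<lambda>z. fst (snd z)) \<in> X \<rightarrow>\<^sub>M count_space UNIV"
  unfolding Xbar_def by measurable

lemma clock_nonneg: "z \<in> space X \<Longrightarrow> 0 \<le> clock z"
  by (auto simp: Xbar_def space_pair_measure space_restrict_space)

lemma measurable_lam [measurable]: "lam \<in> borel_measurable borel"
  by (rule borel_measurable_continuous_onI) (rule lam_cont)

lemma measurable_p [measurable]: "p i j \<in> borel_measurable borel"
  by (rule borel_measurable_continuous_onI) (rule p_cont)

lemma flow_cont: "continuous_on UNIV (\<lambda>(u, y). S i (max 0 u) y)"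
proof -
  have S: "continuous_on ({0..} \<times> UNIV) (\<lambda>(t, y). S i t y)"
    using semiflow by (simp add: cont_semiflow_def)
  have "continuous_on UNIV (\<lambda>q. (max 0 (fst q :: real), snd q :: 'y))"
    by (intro continuous_intros)
  from continuous_on_compose2[OF S this] show ?thesis
    by (simp add: case_prod_unfold image_subset_iff)
qed

lemma measurable_flow [measurable]: "(\<lambda>(z, u). flow z u) \<in> X \<Otimes>\<^sub>M borel \<rightarrow>\<^sub>M borel"
proof -
  have "(\<lambda>(u, y). S i (max 0 u) y) \<in> borel \<Otimes>\<^sub>M borel \<rightarrow>\<^sub>M borel" for i
    unfolding borel_prod by (rule borel_measurable_continuous_onI) (rule flow_cont)
  from measurable_compose[OF _ this, of "\<lambda>q. (snd q, fst (fst q))" "X \<Otimes>\<^sub>M borel"]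
  have "(\<lambda>q. S i (max 0 (snd q)) (fst (fst q))) \<in> X \<Otimes>\<^sub>M borel \<rightarrow>\<^sub>M borel" for i
    by simp
  then have "(\<lambda>q. S (fst (snd (fst q))) (max 0 (snd q)) (fst (fst q))) \<in> X \<Otimes>\<^sub>M borel \<rightarrow>\<^sub>M borel"
    by (rule measurable_compose_countable) measurable
  then show ?thesis by (simp add: flow_def case_prod_unfold)
qed

lemma measurable_hazard [measurable]: "(\<lambda>(z, u). hazard z u) \<in> borel_measurable (X \<Otimes>\<^sub>M borel)"
proof -
  have [measurable]: "(\<lambda>w. flow (fst (fst w)) (snd w)) \<in> (X \<Otimes>\<^sub>M borel) \<Otimes>\<^sub>M lborel \<rightarrow>\<^sub>M borel"
    using measurable_compose[OF _ measurable_flow, of "\<lambda>w. (fst (fst w), snd w)" "(X \<Otimes>\<^sub>M borel) \<Otimes>\<^sub>M lborel"]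
    by simp
  have "(\<lambda>(q, h). (if 0 \<le> h \<and> h \<le> snd q then lam (flow (fst q) h) else 0))
      \<in> borel_measurable ((X \<Otimes>\<^sub>M borel) \<Otimes>\<^sub>M lborel)"
    unfolding case_prod_unfold by measurable
  then have "(\<lambda>(q, h). indicator {0..snd q} h *\<^sub>R lam (flow (fst q) h))
      \<in> borel_measurable ((X \<Otimes>\<^sub>M borel) \<Otimes>\<^sub>M lborel)"
    by (rule measurable_cong[THEN iffD1, rotated]) (auto split: split_indicator)
  from lborel.borel_measurable_lebesgue_integral[OF this] show ?thesis
    by (simp add: hazard_def set_lebesgue_integral_def case_prod_unfold)
qed

lemma measurable_wait_density [measurable]:
  "(\<lambda>(z, u). wait_density z u) \<in> borel_measurable (X \<Otimes>\<^sub>M borel)"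
  unfolding wait_density_def by measurable

text \<open>Measurability in the mode is automatic because there are finitely many modes; this reduces the
  claim to each fixed function \<open>p i j\<close>.\<close>

lemma measurable_landing_integrand:
  assumes [measurable]: "A \<in> sets X"
  shows "(\<lambda>(q, v). \<Sum>j\<in>UNIV. ennreal (p (fst (snd (fst q))) j v)
            * indicator A (v, j, clock (fst q) + max 0 (snd q))) \<in> borel_measurable ((X \<Otimes>\<^sub>M borel) \<Otimes>\<^sub>M borel)"
proof -
  have [measurable]: "(\<lambda>w. p (fst (snd (fst (fst w)))) j (snd w)) \<in> borel_measurable ((X \<Otimes>\<^sub>M borel) \<Otimes>\<^sub>M borel)" for j
    by (rule measurable_compose_countable[where f="\<lambda>i w. p i j (snd w)"]) measurable
  have "(\<lambda>w. clock (fst (fst w)) + max 0 (snd (fst w))) \<in> (X \<Otimes>\<^sub>M borel) \<Otimes>\<^sub>M borel \<rightarrow>\<^sub>M restrict_space borel {0..}"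
    by (rule measurable_restrict_space2) (auto simp: space_pair_measure dest!: clock_nonneg)
  then have [measurable]: "(\<lambda>w. (snd w, j, clock (fst (fst w)) + max 0 (snd (fst w)))) \<in> (X \<Otimes>\<^sub>M borel) \<Otimes>\<^sub>M borel \<rightarrow>\<^sub>M X" for j
    unfolding Xbar_def by (intro measurable_Pair) (auto simp flip: Xbar_def)
  show ?thesis unfolding case_prod_unfold by measurable
qed

lemma measurable_landing [measurable]:
  assumes A: "A \<in> sets X"
  shows "(\<lambda>(z, u). landing z u A) \<in> borel_measurable (X \<Otimes>\<^sub>M borel)"
proof -
  have J: "J \<in> borel \<rightarrow>\<^sub>M subprob_algebra borel"
    by (rule measurable_prob_algebraD) (rule J_kernel)
  have "(\<lambda>q. J (flow (fst q) (snd q))) \<in> X \<Otimes>\<^sub>M borel \<rightarrow>\<^sub>M subprob_algebra borel"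
    by (rule measurable_compose[OF _ J]) (use measurable_flow in \<open>simp add: case_prod_unfold\<close>)
  from nn_integral_measurable_subprob_algebra2[OF measurable_landing_integrand[OF A] this]
  show ?thesis by (simp add: landing_def case_prod_unfold)
qed

lemma measurable_landing_point:
  assumes z: "z \<in> space X" and A: "A \<in> sets X"
  shows "(\<lambda>v. \<Sum>j\<in>UNIV. ennreal (p (fst (snd z)) j v) * indicator A (v, j, clock z + max 0 u)) \<in> borel_measurable borel"
  using measurable_compose[OF measurable_Pair1' measurable_landing_integrand[OF A], of "(z, u)"] z
  by (simp add: space_pair_measure case_prod_unfold)

lemma J_prob: "prob_space (J y)" "sets (J y) = sets borel"
  using measurable_space[OF J_kernel, of y] by (auto simp: space_prob_algebra)

text \<open>
  The kernel is introduced as a measure generated from a set function, whose values are only known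
  once that function is seen to be countably additive. This is the inner half of that fact.
\<close>

lemma landing_UN:
  assumes z: "z \<in> space X" and A: "range A \<subseteq> sets X" "disjoint_family A"
  shows "(\<Sum>n. landing z u (A n)) = landing z u (\<Union>n. A n)"
proof -
  have "(\<Sum>n. landing z u (A n)) = (\<integral>\<^sup>+v. (\<Sum>n. \<Sum>j\<in>UNIV. ennreal (p (fst (snd z)) j v)
      * indicator (A n) (v, j, clock z + max 0 u)) \<partial>J (flow z u))"
    unfolding landing_def using A measurable_landing_point[OF z]
    by (intro nn_integral_suminf[symmetric]) (auto simp: measurable_cong_sets[OF J_prob(2) refl])
  also have "\<dots> = landing z u (\<Union>n. A n)"
    unfolding landing_def
    by (subst suminf_sum, simp)
       (simp only: ennreal_suminf_cmult suminf_indicator[OF A(2)])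
  finally show ?thesis .
qed

lemma measurable_wait_density_point [measurable]: "z \<in> space X \<Longrightarrow> wait_density z \<in> borel_measurable borel"
  using measurable_compose[OF measurable_Pair1' measurable_wait_density, of z] by (simp add: case_prod_unfold)

lemma measurable_landing_time [measurable]:
  "z \<in> space X \<Longrightarrow> A \<in> sets X \<Longrightarrow> (\<lambda>u. landing z u A) \<in> borel_measurable borel"
  using measurable_compose[OF measurable_Pair1' measurable_landing, of z] by (simp add: case_prod_unfold)

lemma sets_P: "sets (P z) = sets X" and space_P: "space (P z) = space X"
  by (cases z, simp add: Pbar_def sets.space_closed sets.sigma_sets_eq)+

lemma emeasure_P:
  assumes z: "z \<in> space X" and A: "A \<in> sets X"
  shows "emeasure (P z) A = (\<integral>\<^sup>+u. wait_density z u * landing z u A \<partial>lborel)"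
proof -
  let ?\<mu> = "\<lambda>A. \<integral>\<^sup>+u. wait_density z u * landing z u A \<partial>lborel"
  obtain y i s where yis: "z = (y, i, s)" by (cases z)
  have haz: "hazard z u = Lam S lam y i u" if "0 \<le> u" for u
    unfolding hazard_def Lam_def by (rule set_lebesgue_integral_cong) (auto simp: flow_def yis)
  have P: "P z = measure_of (space X) (sets X) ?\<mu>"
    unfolding yis Pbar_def case_prod_conv
    by (intro measure_of_eq sets.space_closed nn_integral_cong)
       (auto simp: wait_density_def landing_def flow_def haz[unfolded yis] split: split_indicator)
  show ?thesis
  proof (rule emeasure_measure_of[OF P])
    show "countably_additive (sets (P z)) ?\<mu>"
    proof (rule countably_additiveI)
      fix A :: "nat \<Rightarrow> ('y \<times> 'i \<times> real) set"
      assume A: "range A \<subseteq> sets (P z)" "disjoint_family A"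
      then have [measurable]: "A n \<in> sets X" for n by (auto simp: sets_P)
      have "(\<Sum>n. ?\<mu> (A n)) = (\<integral>\<^sup>+u. (\<Sum>n. wait_density z u * landing z u (A n)) \<partial>lborel)"
        using z by (intro nn_integral_suminf[symmetric]) measurable
      also have "\<dots> = ?\<mu> (\<Union>n. A n)"
        using A z by (simp add: ennreal_suminf_cmult landing_UN sets_P)
      finally show "(\<Sum>n. ?\<mu> (A n)) = ?\<mu> (\<Union>n. A n)" .
    qed
  qed (use A in \<open>auto simp: positive_def landing_def sets_P sets.space_closed sets.sets_into_space\<close>)
qed

text \<open>
  The new clock is determined by the waiting time, and the jump distributions \<open>J\<close> and \<open>p\<close> have total
  mass one, so they drop out of events that concern the clock only.
\<close>

lemma landing_clock:
  assumes z: "z \<in> space X"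
  shows "landing z u (clock -` T \<inter> space X) = indicator T (clock z + max 0 u)"
proof -
  interpret prob_space "J (flow z u)" by (rule J_prob)
  have "(v, j, clock z + max 0 u) \<in> space X" for v :: 'y and j :: 'i
    using clock_nonneg[OF z] by (auto simp: Xbar_def space_pair_measure space_restrict_space)
  then have "landing z u (clock -` T \<inter> space X)
      = (\<integral>\<^sup>+v. (\<Sum>j\<in>UNIV. ennreal (p (fst (snd z)) j v)) * indicator T (clock z + max 0 u) \<partial>J (flow z u))"
    unfolding landing_def by (auto simp: sum_distrib_right indicator_def intro!: nn_integral_cong)
  also have "\<dots> = indicator T (clock z + max 0 u)"
    using p_nonneg p_sum by (simp add: emeasure_space_1)
  finally show ?thesis .
qed

text \<open>
  This reduces every later computation with the kernel to an integral over the waiting time on the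
  real line.
\<close>

lemma nn_integral_P_clock:
  assumes z: "z \<in> space X" and f [measurable]: "f \<in> borel_measurable borel"
  shows "(\<integral>\<^sup>+w. f (clock w) \<partial>P z) = (\<integral>\<^sup>+u. wait_density z u * f (clock z + max 0 u) \<partial>lborel)"
proof -
  note [measurable_cong] = sets_P
  note [measurable] = measurable_wait_density_point[OF z]
  have "distr (P z) borel clock = distr (density lborel (wait_density z)) borel (\<lambda>u. clock z + max 0 u)"
  proof (rule measure_eqI)
    fix T assume "T \<in> sets (distr (P z) borel clock)"
    then have [measurable]: "T \<in> sets borel" by simp
    have "emeasure (distr (P z) borel clock) T = emeasure (P z) (clock -` T \<inter> space X)"
      by (subst emeasure_distr) (auto simp: space_P)
    also have "\<dots> = (\<integral>\<^sup>+u. wait_density z u * indicator T (clock z + max 0 u) \<partial>lborel)"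
      by (subst emeasure_P[OF z]) (simp_all add: landing_clock[OF z])
    also have "\<dots> = emeasure (distr (density lborel (wait_density z)) borel (\<lambda>u. clock z + max 0 u)) T"
      by (simp add: nn_integral_distr nn_integral_density flip: nn_integral_indicator)
    finally show "emeasure (distr (P z) borel clock) T = \<dots>" .
  qed simp
  then have "(\<integral>\<^sup>+w. f w \<partial>distr (P z) borel clock)
      = (\<integral>\<^sup>+w. f w \<partial>distr (density lborel (wait_density z)) borel (\<lambda>u. clock z + max 0 u))"
    by simp
  then show ?thesis
    by (simp add: nn_integral_distr nn_integral_density)
qed

lemma lam_flow_cont: "continuous_on UNIV (\<lambda>u. lam (flow z u))"
proof -
  have "continuous_on UNIV (\<lambda>u. (u, fst z))" by (intro continuous_intros)
  from continuous_on_compose2[OF flow_cont this] have "continuous_on UNIV (flow z)"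
    by (simp add: flow_def[abs_def])
  from continuous_on_compose2[OF lam_cont this] show ?thesis by simp
qed

lemma hazard_ge: "0 \<le> u \<Longrightarrow> lam_lo * u \<le> hazard z u"
  unfolding hazard_def using lam_flow_cont lam_lo_pos lam_bounds(1) by (rule cumulative_hazard_ge)

lemma hazard_0: "hazard z 0 = 0"
  unfolding hazard_def by (subst interval_integral_Icc[symmetric]) simp_all

lemma wait_tail:
  assumes "0 \<le> a"
  shows "(\<integral>\<^sup>+u. wait_density z u * indicator {a..} u \<partial>lborel) = ennreal (exp (- hazard z a))"
proof -
  have "(\<integral>\<^sup>+u. wait_density z u * indicator {a..} u \<partial>lborel)
      = (\<integral>\<^sup>+u. ennreal (lam (flow z u) * exp (- hazard z u)) * indicator {a..} u \<partial>lborel)"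
    using assms by (intro nn_integral_cong) (auto simp: wait_density_def split: split_indicator)
  also have "\<dots> = ennreal (exp (- hazard z a))"
    unfolding hazard_def
    by (rule nn_integral_hazard_tail[OF lam_flow_cont lam_lo_pos lam_bounds(1) assms])
  finally show ?thesis .
qed

text \<open>The total mass of the kernel is the probability that the waiting time is at least \<open>0\<close>.\<close>

lemma P_kernel: "P \<in> X \<rightarrow>\<^sub>M prob_algebra X"
proof -
  have prob: "prob_space (P z)" if z: "z \<in> space X" for z
  proof
    have "emeasure (P z) (space (P z)) = (\<integral>\<^sup>+u. wait_density z u \<partial>lborel)"
      using nn_integral_P_clock[OF z, of "\<lambda>_. 1"] by simp
    also have "\<dots> = (\<integral>\<^sup>+u. wait_density z u * indicator {0..} u \<partial>lborel)"
      by (intro nn_integral_cong) (auto simp: wait_density_def split: split_indicator)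
    also have "\<dots> = 1"
      by (subst wait_tail) (simp_all add: hazard_0)
    finally show "emeasure (P z) (space (P z)) = 1" .
  qed
  show ?thesis
  proof (rule measurable_prob_algebraI[OF prob], assumption, rule measurable_subprob_algebra)
    fix A assume A [measurable]: "A \<in> sets X"
    have "(\<lambda>z. \<integral>\<^sup>+u. wait_density z u * landing z u A \<partial>lborel) \<in> borel_measurable X"
      by measurable
    then show "(\<lambda>z. emeasure (P z) A) \<in> borel_measurable X"
      by (subst measurable_cong[OF emeasure_P[OF _ A]])
  qed (auto intro: prob_space_imp_subprob_space prob simp: sets_P)
qed

section \<open>Comparison with Poisson weights\<close>

text \<open>
  For \<open>l = lam_hi\<close> this is the probability that a Poisson process of rate \<open>lam_hi\<close> has exactly \<open>n\<close>
  points between \<open>s\<close> and \<open>t\<close>. The decay rate \<open>l\<close> is kept free because the two values \<open>lam_lo\<close> and \<open>0\<close>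
  serve different purposes.
\<close>

definition weight :: "real \<Rightarrow> real \<Rightarrow> nat \<Rightarrow> real \<Rightarrow> ennreal"
  where "weight l t n s = ennreal (exp (- l * (t - s)) * (lam_hi * (t - s)) ^ n / fact n) * indicator {..t} s"

lemma measurable_weight [measurable]: "weight l t n \<in> borel_measurable borel"
  unfolding weight_def[abs_def] by measurable

lemma lam_hi_pos: "0 < lam_hi"
  using lam_lo_pos lam_bounds[of undefined] by linarith

text \<open>
  With \<open>r\<close> the remaining time, the waiting time contributes at most \<open>lam_hi * exp (- l * u)\<close> and the
  weight after it \<open>exp (- l * (r - u)) * (lam_hi * (r - u)) ^ n / fact n\<close>. The product depends on \<open>u\<close>
  only through \<open>(r - u) ^ n\<close>, which integrates to \<open>r ^ Suc n / Suc n\<close>.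
\<close>

lemma P_weight_le:
  assumes z: "z \<in> space X" and l: "l \<le> lam_lo"
  shows "(\<integral>\<^sup>+w. weight l t n (clock w) \<partial>P z) \<le> weight l t (Suc n) (clock z)"
proof (cases "clock z \<le> t")
  case False
  then have "weight l t n (clock z + max 0 u) = 0" for u
    by (auto simp: weight_def split: split_indicator)
  then show ?thesis by (simp add: nn_integral_P_clock[OF z])
next
  case True
  define r where "r = t - clock z"
  have r: "0 \<le> r" using True by (simp add: r_def)
  let ?c = "lam_hi ^ Suc n * exp (- l * r)"
  have "(\<integral>\<^sup>+w. weight l t n (clock w) \<partial>P z) = (\<integral>\<^sup>+u. wait_density z u * weight l t n (clock z + max 0 u) \<partial>lborel)"
    by (rule nn_integral_P_clock[OF z]) measurable
  also have "\<dots> \<le> (\<integral>\<^sup>+u. ennreal (?c * ((r - u) ^ n / fact n)) * indicator {0..r} u \<partial>lborel)"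
  proof (rule nn_integral_mono)
    fix u :: real
    show "wait_density z u * weight l t n (clock z + max 0 u)
        \<le> ennreal (?c * ((r - u) ^ n / fact n)) * indicator {0..r} u"
    proof (cases "u \<in> {0..r}")
      case False
      then show ?thesis
        by (auto simp: wait_density_def weight_def r_def split: split_indicator)
    next
      case u: True
      have eq: "t - (clock z + u) = r - u" by (simp add: r_def)
      have "l * u \<le> lam_lo * u" using l u by (intro mult_right_mono) auto
      also have "\<dots> \<le> hazard z u" using u by (intro hazard_ge) auto
      finally have e: "exp (- hazard z u) \<le> exp (- l * u)" by simp
      have "lam (flow z u) * exp (- hazard z u) * (exp (- l * (r - u)) * (lam_hi * (r - u)) ^ n / fact n)
          \<le> lam_hi * exp (- l * u) * (exp (- l * (r - u)) * (lam_hi * (r - u)) ^ n / fact n)"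
        using u lam_hi_pos e lam_bounds(2) by (intro mult_right_mono mult_mono) auto
      also have "\<dots> = lam_hi * (exp (- l * u) * exp (- l * (r - u))) * ((lam_hi * (r - u)) ^ n / fact n)"
        by simp
      also have "exp (- l * u) * exp (- l * (r - u)) = exp (- l * r)"
        by (simp add: algebra_simps flip: exp_add)
      also have "lam_hi * exp (- l * r) * ((lam_hi * (r - u)) ^ n / fact n) = ?c * ((r - u) ^ n / fact n)"
        by (simp add: power_mult_distrib)
      finally have "ennreal (lam (flow z u) * exp (- hazard z u))
            * ennreal (exp (- l * (r - u)) * (lam_hi * (r - u)) ^ n / fact n) \<le> ennreal (?c * ((r - u) ^ n / fact n))"
        using u lam_hi_pos less_imp_le[OF lam_pos]
        by (subst ennreal_mult[symmetric]) (auto intro!: ennreal_leI)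
      with u show ?thesis
        by (simp add: wait_density_def weight_def eq) (simp add: r_def split: split_indicator)
    qed
  qed
  also have "\<dots> = ennreal (- ?c * (r - r) ^ Suc n / fact (Suc n) - (- ?c * (r - 0) ^ Suc n / fact (Suc n)))"
  proof (rule nn_integral_FTC_Icc)
    fix u assume u: "u \<in> {0..r}"
    have "((\<lambda>u. - ?c * (r - u) ^ Suc n / fact (Suc n)) has_real_derivative
        - ?c * (real (Suc n) * (r - u) ^ n * (- 1)) / fact (Suc n)) (at u)"
      by (auto intro!: derivative_eq_intros simp del: power_Suc)
    moreover have "- ?c * (real (Suc n) * (r - u) ^ n * (- 1)) / fact (Suc n) = ?c * ((r - u) ^ n / fact n)"
      by (simp add: divide_simps del: of_nat_Suc)
    ultimately show "((\<lambda>u. - ?c * (r - u) ^ Suc n / fact (Suc n)) has_real_derivative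
        ?c * ((r - u) ^ n / fact n)) (at u)" by (simp only:)
    show "0 \<le> ?c * ((r - u) ^ n / fact n)" using u lam_hi_pos by simp
  qed (use r in auto)
  also have "\<dots> = weight l t (Suc n) (clock z)"
    using True by (simp add: weight_def r_def power_mult_distrib mult_ac)
  finally show ?thesis .
qed

text \<open>
  The step that starts the comparison: the jump that falls after \<open>t\<close> supplies the
  factor \<open>exp (- lam_lo * (t - s))\<close> that all later steps preserve.
\<close>

lemma P_no_jump_le:
  assumes z: "z \<in> space X"
  shows "(\<integral>\<^sup>+w. indicator {..t} (clock z) * indicator {t<..} (clock w) \<partial>P z) \<le> weight lam_lo t 0 (clock z)"
proof (cases "clock z \<le> t")
  case True
  have "(\<integral>\<^sup>+w. indicator {..t} (clock z) * indicator {t<..} (clock w) \<partial>P z)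
      = (\<integral>\<^sup>+w. indicator {t<..} (clock w) \<partial>P z)" using True by simp
  also have "\<dots> = (\<integral>\<^sup>+u. wait_density z u * indicator {t<..} (clock z + max 0 u) \<partial>lborel)"
    by (rule nn_integral_P_clock[OF z]) measurable
  also have "\<dots> \<le> (\<integral>\<^sup>+u. wait_density z u * indicator {t - clock z..} u \<partial>lborel)"
    using True by (intro nn_integral_mono) (auto simp: max_def split: split_indicator)
  also have "\<dots> = ennreal (exp (- hazard z (t - clock z)))"
    using True by (intro wait_tail) simp
  also have "\<dots> \<le> weight lam_lo t 0 (clock z)"
    using True hazard_ge[of "t - clock z" z] by (simp add: weight_def)
  finally show ?thesis .
qed simp

section \<open>The jump times of the chain\<close>

context
  fixes x :: "'y \<times> 'i \<times> real"
  assumes x: "x \<in> space X"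
begin

interpretation markov_kernel X P x
  by unfold_locales (rule P_kernel, rule x)

text \<open>
  Each step back along the path trades one index of the path for one index of the weight, so the
  induction needs the statement for all \<open>m\<close> at once.
\<close>

lemma law_weight_le:
  assumes l: "l \<le> lam_lo"
  shows "(\<integral>\<^sup>+\<omega>. weight l t m (clock (\<omega> k)) \<partial>law) \<le> weight l t (m + k) (clock x)"
proof (induction k arbitrary: m)
  case 0
  show ?case by (subst nn_integral_law_start) auto
next
  case (Suc k)
  have "(\<integral>\<^sup>+\<omega>. weight l t m (clock (\<omega> (Suc k))) \<partial>law) = (\<integral>\<^sup>+\<omega>. (\<integral>\<^sup>+w. weight l t m (clock w) \<partial>P (\<omega> k)) \<partial>law)"
    by (rule nn_integral_law_step[where h="\<lambda>_ w. weight l t m (clock w)"]) measurable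
  also have "\<dots> \<le> (\<integral>\<^sup>+\<omega>. weight l t (Suc m) (clock (\<omega> k)) \<partial>law)"
    by (intro nn_integral_mono P_weight_le coordinate_in_space l)
  also have "\<dots> \<le> weight l t (m + Suc k) (clock x)"
    using Suc.IH[of "Suc m"] by simp
  finally show ?case .
qed

text \<open>For \<open>l = 0\<close> the weight of index \<open>0\<close> is the indicator of \<open>{..t}\<close>.\<close>

lemma law_jump_by_le: "emeasure law {\<omega> \<in> space law. clock (\<omega> k) \<le> t} \<le> weight 0 t k (clock x)"
proof -
  have "emeasure law {\<omega> \<in> space law. clock (\<omega> k) \<le> t} = (\<integral>\<^sup>+\<omega>. weight 0 t 0 (clock (\<omega> k)) \<partial>law)"
    unfolding weight_def
    by (subst nn_integral_indicator[symmetric], measurable, intro nn_integral_cong)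
       (simp split: split_indicator)
  also have "\<dots> \<le> weight 0 t k (clock x)"
    using law_weight_le[of 0 t 0 k] lam_lo_pos by simp
  finally show ?thesis .
qed

lemma law_exactly_le:
  "emeasure law {\<omega> \<in> space law. clock (\<omega> n) \<le> t \<and> t < clock (\<omega> (Suc n))} \<le> weight lam_lo t n (clock x)"
proof -
  have "emeasure law {\<omega> \<in> space law. clock (\<omega> n) \<le> t \<and> t < clock (\<omega> (Suc n))}
      = (\<integral>\<^sup>+\<omega>. indicator {..t} (clock (\<omega> n)) * indicator {t<..} (clock (\<omega> (Suc n))) \<partial>law)"
    by (subst nn_integral_indicator[symmetric], measurable, intro nn_integral_cong)
       (simp split: split_indicator)
  also have "\<dots> = (\<integral>\<^sup>+\<omega>. (\<integral>\<^sup>+w. indicator {..t} (clock (\<omega> n)) * indicator {t<..} (clock w) \<partial>P (\<omega> n)) \<partial>law)"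
    by (rule nn_integral_law_step[where h="\<lambda>z w. indicator {..t} (clock z) * indicator {t<..} (clock w)"]) measurable
  also have "\<dots> \<le> (\<integral>\<^sup>+\<omega>. weight lam_lo t 0 (clock (\<omega> n)) \<partial>law)"
    by (intro nn_integral_mono P_no_jump_le coordinate_in_space)
  also have "\<dots> \<le> weight lam_lo t n (clock x)"
    using law_weight_le[of lam_lo t 0 n] by simp
  finally show ?thesis .
qed

text \<open>
  The probabilities of \<open>clock (\<omega> k) \<le> t\<close> are dominated by an exponential series, so Borel-Cantelli
  applies.
\<close>

lemma AE_finitely_many_jumps: "AE \<omega> in law. finite {k. clock (\<omega> k) \<le> t}"
proof -
  interpret L: prob_space law by (rule prob_space_law)
  let ?A = "\<lambda>k. {\<omega> \<in> space law. clock (\<omega> k) \<le> t}"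
  let ?r = "lam_hi * max 0 (t - clock x)"
  have r: "0 \<le> ?r" using lam_hi_pos by simp
  have le: "measure law (?A k) \<le> ?r ^ k / fact k" for k
  proof -
    have "emeasure law (?A k) \<le> ennreal (?r ^ k / fact k)"
      by (rule order_trans[OF law_jump_by_le]) (auto simp: weight_def max_def split: split_indicator)
    then show ?thesis using r by (simp add: L.emeasure_eq_measure)
  qed
  have "summable (\<lambda>k. measure law (?A k))"
    by (rule summable_comparison_test'[OF summable_exp[of ?r], of 0])
       (use le in \<open>simp add: divide_inverse mult.commute\<close>)
  then have "AE \<omega> in law. \<forall>\<^sub>F k in sequentially. \<omega> \<in> space law - ?A k"
    by (intro borel_cantelli_AE1) (auto simp: less_top[symmetric])
  then show ?thesis
  proof (eventually_elim)
    case (elim \<omega>)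
    then have "\<forall>\<^sub>F k in sequentially. \<not> clock (\<omega> k) \<le> t"
      by eventually_elim auto
    then show ?case
      by (simp add: eventually_cofinite flip: cofinite_eq_sequentially)
  qed
qed

text \<open>
  Paths are arbitrary functions, so even the initial clock is correct only almost surely. It is what
  makes the set of jump times up to \<open>t\<close> nonempty.
\<close>

lemma AE_start: "AE \<omega> in law. clock (\<omega> 0) = clock x"
proof -
  have "(\<integral>\<^sup>+\<omega>. indicator {\<omega> \<in> space law. clock (\<omega> 0) \<noteq> clock x} \<omega> \<partial>law)
      = (\<integral>\<^sup>+\<omega>. indicator (- {clock x}) (clock (\<omega> 0)) \<partial>law)"
    by (intro nn_integral_cong) (auto split: split_indicator)
  also have "\<dots> = 0"
    by (subst nn_integral_law_start) auto
  finally show ?thesis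
    by (subst AE_iff_measurable[OF _ refl]) auto
qed

text \<open>
  Up to a null set, \<open>eta \<omega> t\<close> is the maximum of a finite nonempty set. If it equals \<open>n\<close>, then \<open>n\<close>
  belongs to that set and \<open>Suc n\<close> does not.
\<close>

lemma measure_eta_le:
  assumes t: "clock x \<le> t"
  shows "measure law {\<omega> \<in> space law. eta \<omega> t = n}
    \<le> exp (- lam_lo * (t - clock x)) * (lam_hi * (t - clock x)) ^ n / fact n"
proof -
  interpret L: prob_space law by (rule prob_space_law)
  let ?A = "{\<omega> \<in> space law. clock (\<omega> n) \<le> t \<and> t < clock (\<omega> (Suc n))}"
  have "AE \<omega> in law. \<omega> \<in> {\<omega> \<in> space law. eta \<omega> t = n} \<longrightarrow> \<omega> \<in> ?A"
    using AE_finitely_many_jumps[of t] AE_start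
  proof eventually_elim
    case (elim \<omega>)
    have fin: "finite {k. clock (\<omega> k) \<le> t}" by (rule elim)
    have "0 \<in> {k. clock (\<omega> k) \<le> t}" using elim(2) t by simp
    then have "{k. clock (\<omega> k) \<le> t} \<noteq> {}" by blast
    from Max_in[OF fin this] Max_ge[OF fin, of "Suc (eta \<omega> t)"]
    show ?case by (auto simp: eta_def not_le[symmetric])
  qed
  then have "measure law {\<omega> \<in> space law. eta \<omega> t = n} \<le> measure law ?A"
    by (rule L.finite_measure_mono_AE) measurable
  moreover have "ennreal (measure law ?A) \<le> ennreal (exp (- lam_lo * (t - clock x)) * (lam_hi * (t - clock x)) ^ n / fact n)"
    using law_exactly_le[of n t] t by (simp add: weight_def L.emeasure_eq_measure)
  ultimately show ?thesis
    using t lam_hi_pos by simp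
qed

end

end

section \<open>The distribution of the number of jumps\<close>

theorem lemma6p2:
  fixes S :: "'i::finite \<Rightarrow> real \<Rightarrow> 'y::polish_space \<Rightarrow> 'y"
    and p :: "'i \<Rightarrow> 'i \<Rightarrow> 'y \<Rightarrow> real"
    and lam :: "'y \<Rightarrow> real"
    and J :: "'y \<Rightarrow> 'y measure"
    and lam_lo lam_hi :: real
    and x :: "'y \<times> 'i" and t :: real and n :: nat
  assumes "\<And>i. cont_semiflow (S i)"
    and "\<And>i j. continuous_on UNIV (p i j)"
    and "\<And>i j y. 0 \<le> p i j y \<and> p i j y \<le> 1"
    and "\<And>i y. (\<Sum>j\<in>UNIV. p i j y) = 1"
    and "continuous_on UNIV lam"
    and "\<And>y. 0 < lam y"
    and "0 < lam_lo" and "0 < lam_hi"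
    and "\<And>y. lam_lo \<le> lam y \<and> lam y \<le> lam_hi"
    and "J \<in> borel \<rightarrow>\<^sub>M prob_algebra borel"
    and "0 \<le> t"
  shows "\<P>(\<omega> in markov_law Xbar (Pbar S p lam J) (fst x, snd x, 0). eta \<omega> t = n)
         \<le> exp (- lam_lo * t) * (lam_hi * t) ^ n / fact n"
proof -
  interpret semiflow_jump_model S p lam J lam_lo lam_hi
    by unfold_locales (use assms in auto)
  have "(fst x, snd x, 0) \<in> space Xbar"
    by (simp add: Xbar_def space_pair_measure space_restrict_space)
  from measure_eta_le[OF this, of t n] \<open>0 \<le> t\<close> show ?thesis by simp
qed

end
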